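(* Let $(R_n)_{n\ge1}$ be a sequence of probability distributions on $\mathbb{R}\times\mathbb{R}$ converging weakly to a probability distribution $R$. (1) If each $R_n$ is stochastically ordered, then $R$ is stochastically ordered. (2) If each $R_n$ is TP2, then $R$ is TP2.
   Context: For sets, $A_1<A_2$ means $a_1<a_2$ for all $a_1\in A_1,a_2\in A_2$. A probability distribution $R$ on $\mathbb{R}\times\mathbb{R}$ with first marginal $P=R(\cdot\times\mathbb{R})$ is called here stochastically ordered if $R(A_1\times(y,\infty))P(A_2)\le P(A_1)R(A_2\times(y,\infty))$ for arbitrary Borel sets $A_1<A_2$ and $y\in\mathbb{R}$. (Equivalently, the conditional distribution of the second coordinate given the first can be described by a stochastic kernel that is non-decreasing, with respect to the usual stochastic order, on the range $\{x\in\mathbb{R}:P((-\infty,x])>0,\,P([x,\infty))>0\}$.) $R$ is called TP2 if $R(A_1\times B_2)R(A_2\times B_1)\le R(A_1\times B_1)R(A_2\times B_2)$ for arbitrary Borel sets $A_1<A_2$ and $B_1<B_2$. (Equivalently, the same holds with the likelihood ratio order in place of the usual stochastic order.) *)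

theory Defs
  imports "HOL-Probability.Probability"
begin

(* The Borel sigma-algebra of the plane agrees with the product sigma-algebra (borel_prod). *)
definition plane_distribution :: "(real \<times> real) measure \<Rightarrow> bool" where
  "plane_distribution R \<longleftrightarrow> prob_space R \<and> sets R = sets borel"

(* Vacuously true if one of the two sets is empty. *)
definition set_less :: "real set \<Rightarrow> real set \<Rightarrow> bool" where
  "set_less A B \<longleftrightarrow> (\<forall>a\<in>A. \<forall>b\<in>B. a < b)"

definition first_marginal :: "(real \<times> real) measure \<Rightarrow> real measure" where
  "first_marginal R = distr R borel fst"

definition stochastically_ordered :: "(real \<times> real) measure \<Rightarrow> bool" where
  "stochastically_ordered R \<longleftrightarrow>
     (\<forall>A1\<in>sets borel. \<forall>A2\<in>sets borel. \<forall>y. set_less A1 A2 \<longrightarrow>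
        measure R (A1 \<times> {y<..}) * measure (first_marginal R) A2
          \<le> measure (first_marginal R) A1 * measure R (A2 \<times> {y<..}))"

definition TP2 :: "(real \<times> real) measure \<Rightarrow> bool" where
  "TP2 R \<longleftrightarrow>
     (\<forall>A1\<in>sets borel. \<forall>A2\<in>sets borel. \<forall>B1\<in>sets borel. \<forall>B2\<in>sets borel.
        set_less A1 A2 \<longrightarrow> set_less B1 B2 \<longrightarrow>
        measure R (A1 \<times> B2) * measure R (A2 \<times> B1)
          \<le> measure R (A1 \<times> B1) * measure R (A2 \<times> B2))"

(* The library's weak_conv_m is formulated through distribution functions on the real line
   only; in the plane we use convergence of integrals of bounded continuous functions. *)
definition weakly_converges :: "(nat \<Rightarrow> (real \<times> real) measure) \<Rightarrow> (real \<times> real) measure \<Rightarrow> bool" where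
  "weakly_converges Rs R \<longleftrightarrow>
     (\<forall>f :: real \<times> real \<Rightarrow> real. continuous_on UNIV f \<longrightarrow> bounded (range f) \<longrightarrow>
        (\<lambda>n. integral\<^sup>L (Rs n) f) \<longlonglongrightarrow> integral\<^sup>L R f)"

end

theory Submission
  imports Defs
begin

text \<open>
  Both order properties are inequalities between products of probabilities of rectangles.
  For open sets \<open>G\<close> and closed sets \<open>F\<close> the portmanteau theorem bounds \<open>R G\<close> from above and
  \<open>R F\<close> from below by limits along the sequence, so such an inequality passes to the limit, with
  closures on its larger side. Applied to shrinking open neighbourhoods of compact sets, which
  remain ordered if the compact sets are, this gives the inequality for compact sides;
  inner regularity of the marginals extends it to Borel sides.
\<close>

section \<open>Measurability of rectangles, and the marginal as the mass of strips\<close>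

lemma plane_distributionD:
  assumes "plane_distribution R"
  shows "prob_space R" "sets R = sets borel" "space R = UNIV"
  using assms sets_eq_imp_space_eq[of R borel] by (auto simp: plane_distribution_def)

lemma rectangle_in_sets:
  assumes "plane_distribution R" "A \<in> sets borel" "B \<in> sets borel"
  shows "A \<times> B \<in> sets R"
  using assms by (simp add: plane_distributionD borel_Times)

lemma
  assumes "plane_distribution R"
  shows fst_measurable: "fst \<in> borel_measurable R"
    and snd_measurable: "snd \<in> borel_measurable R"
  unfolding measurable_cong_sets[OF plane_distributionD(2)[OF assms] refl]
  by (intro borel_measurable_continuous_onI continuous_intros)+

text \<open>With the marginal written as the mass of a strip, the stochastic order becomes an
  inequality between rectangles and falls under the same limit argument as
  \<open>TP2\<close>.\<close>

lemma measure_first_marginal: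
  assumes "plane_distribution R" "A \<in> sets borel"
  shows "measure (first_marginal R) A = measure R (A \<times> UNIV)"
proof -
  have "fst \<in> measurable R (borel :: real measure)"
    by (rule fst_measurable[OF assms(1)])
  moreover have "fst -` A = A \<times> (UNIV :: real set)" by auto
  ultimately show ?thesis
    using assms by (simp add: first_marginal_def measure_distr plane_distributionD)
qed

section \<open>Open and closed sets under weak convergence\<close>

text \<open>Truncation at \<open>l\<close> discards any excess, so a bound on the lower limit
  becomes a genuine convergence. In this form such bounds can be multiplied.\<close>

lemma tendsto_min_of_eventually_gr:
  fixes f :: "nat \<Rightarrow> real"
  assumes "\<And>c. c < l \<Longrightarrow> eventually (\<lambda>n. c < f n) sequentially"
  shows "(\<lambda>n. min (f n) l) \<longlonglongrightarrow> l"
proof (rule order_tendstoI)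
  fix c assume "c < l"
  from assms[OF this] show "eventually (\<lambda>n. c < min (f n) l) sequentially"
    by eventually_elim (use \<open>c < l\<close> in simp)
qed (simp add: min_less_iff_disj)

text \<open>A continuous function between the indicators of a compact \<open>K\<close> inside
  \<open>G\<close> and of \<open>G\<close> has an integral at least \<open>measure R K\<close> under
  \<open>R\<close> and at most \<open>measure (Rs n) G\<close> under \<open>Rs n\<close>. By inner
  regularity \<open>K\<close> can carry almost all the mass of \<open>G\<close>.\<close>

lemma weakly_converges_open:
  assumes Rs: "\<And>n. n \<ge> 1 \<Longrightarrow> plane_distribution (Rs n)" and R: "plane_distribution R"
    and conv: "weakly_converges Rs R" and G: "open G"
  shows "(\<lambda>n. min (measure (Rs n) G) (measure R G)) \<longlonglongrightarrow> measure R G"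
proof (rule tendsto_min_of_eventually_gr)
  fix c assume c: "c < measure R G"
  interpret prob_space R using R by (rule plane_distributionD)
  note sets_R = plane_distributionD(2)[OF R]
  show "eventually (\<lambda>n. c < measure (Rs n) G) sequentially"
  \<comment> \<open>Negative \<open>c\<close> is split off because \<open>ennreal\<close> would send
    it to 0.\<close>
  proof (cases "c < 0")
    case True
    then show ?thesis by (simp add: order.strict_trans2)
  next
    case False
    have "emeasure R G = (SUP K \<in> {K. K \<subseteq> G \<and> compact K}. emeasure R K)"
      by (rule inner_regular) (use G sets_R in auto)
    moreover have "ennreal c < emeasure R G"
      using c False by (simp add: emeasure_eq_measure ennreal_less_iff)
    ultimately obtain K where K: "K \<subseteq> G" "compact K" "ennreal c < emeasure R K"
      by (auto simp: less_SUP_iff)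
    then have cK: "c < measure R K"
      using False by (simp add: emeasure_eq_measure ennreal_less_iff)
    have "closed (- G)" "closed K" "- G \<inter> K = {}"
      using G K compact_imp_closed by auto
    then obtain f :: "real \<times> real \<Rightarrow> real" where f: "continuous_on UNIV f"
      "\<And>x. f x \<in> closed_segment 0 1" "\<And>x. x \<in> - G \<Longrightarrow> f x = 0" "\<And>x. x \<in> K \<Longrightarrow> f x = 1"
      using Urysohn[of "- G" K 0 1] by metis
    have f01: "0 \<le> f x" "f x \<le> 1" for x
      using f(2)[of x] by (auto simp: closed_segment_eq_real_ivl)
    have bdd: "bounded (range f)"
      using f01 by (auto simp: bounded_iff intro!: exI[of _ 1])
    have fmeas: "f \<in> borel_measurable borel"
      using f(1) by (rule borel_measurable_continuous_onI)
    have int_f: "integrable M f" if "plane_distribution M" for M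
    proof -
      interpret M: prob_space M using that by (rule plane_distributionD)
      have "f \<in> borel_measurable M"
        using fmeas measurable_cong_sets[OF plane_distributionD(2)[OF that] refl] by blast
      then show ?thesis
        by (rule M.integrable_const_bound[where B = 1, rotated]) (use f01 in auto)
    qed
    have int_ind: "integrable M (indicat_real A)"
      and eq_ind: "integral\<^sup>L M (indicat_real A) = measure M A"
      if "plane_distribution M" "A \<in> sets borel" for M A
    proof -
      interpret M: prob_space M using that by (auto dest: plane_distributionD)
      show "integrable M (indicat_real A)" "integral\<^sup>L M (indicat_real A) = measure M A"
        using plane_distributionD[OF that(1)] that(2)
        by (simp_all add: M.emeasure_eq_measure)
    qed
    have "measure R K = integral\<^sup>L R (indicat_real K)"
      using eq_ind[OF R borel_compact[OF K(2)]] by (rule sym)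
    also have "\<dots> \<le> integral\<^sup>L R f"
      by (rule integral_mono)
         (use K R f01 f(4) in \<open>auto simp: int_ind int_f borel_compact indicator_def\<close>)
    finally have "c < integral\<^sup>L R f" using cK by simp
    moreover have "(\<lambda>n. integral\<^sup>L (Rs n) f) \<longlonglongrightarrow> integral\<^sup>L R f"
      using conv f(1) bdd by (simp add: weakly_converges_def)
    ultimately have "eventually (\<lambda>n. c < integral\<^sup>L (Rs n) f) sequentially"
      by (simp add: order_tendstoD)
    then show ?thesis
      using eventually_ge_at_top[of 1]
    proof eventually_elim
      case (elim n)
      have "integral\<^sup>L (Rs n) f \<le> integral\<^sup>L (Rs n) (indicat_real G)"
        by (rule integral_mono)
           (use Rs[OF elim(2)] G f01 f(3) in \<open>auto simp: int_ind int_f indicator_def\<close>)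
      with elim show ?case using plane_distributionD(3)[OF Rs[OF elim(2)]] by simp
    qed
  qed
qed

text \<open>Apply the open case to the complement: the map sending \<open>x\<close> to
  \<open>1 - x\<close> turns the minimum into a maximum.\<close>

lemma weakly_converges_closed:
  assumes Rs: "\<And>n. n \<ge> 1 \<Longrightarrow> plane_distribution (Rs n)" and R: "plane_distribution R"
    and conv: "weakly_converges Rs R" and F: "closed F"
  shows "(\<lambda>n. max (measure (Rs n) F) (measure R F)) \<longlonglongrightarrow> measure R F"
proof -
  have compl: "measure M (- F) = 1 - measure M F" if "plane_distribution M" for M
    using prob_space.prob_compl[of M F] plane_distributionD[OF that] F
    by (simp add: Compl_eq_Diff_UNIV)
  have "(\<lambda>n. 1 - min (measure (Rs n) (- F)) (measure R (- F))) \<longlonglongrightarrow> 1 - measure R (- F)"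
    by (intro tendsto_intros weakly_converges_open[OF assms(1-3)])
       (use F in \<open>auto simp: open_Compl\<close>)
  \<comment> \<open>The equality is only eventual because \<open>Rs 0\<close> may be any measure,
    and complements are computed in probability spaces.\<close>
  moreover have "eventually (\<lambda>n. 1 - min (measure (Rs n) (- F)) (measure R (- F)) =
      max (measure (Rs n) F) (measure R F)) sequentially"
    using eventually_ge_at_top[of 1]
    by eventually_elim (use Rs R in \<open>auto simp: compl\<close>)
  ultimately show ?thesis
    using R by (simp add: tendsto_cong compl)
qed

text \<open>Replacing each factor by its minimum with the limit value on the left, and by its
  maximum on the right, preserves the inequality since all factors are nonnegative. Now every factor
  converges.\<close>

lemma product_le_limit_open_closed:
  assumes Rs: "\<And>n. n \<ge> 1 \<Longrightarrow> plane_distribution (Rs n)" and R: "plane_distribution R"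
    and conv: "weakly_converges Rs R"
    and "open G1" "open G2" "closed F1" "closed F2"
    and le: "\<And>n. n \<ge> 1 \<Longrightarrow>
      measure (Rs n) G1 * measure (Rs n) G2 \<le> measure (Rs n) F1 * measure (Rs n) F2"
  shows "measure R G1 * measure R G2 \<le> measure R F1 * measure R F2"
proof (rule LIMSEQ_le)
  show "(\<lambda>n. min (measure (Rs n) G1) (measure R G1) * min (measure (Rs n) G2) (measure R G2))
      \<longlonglongrightarrow> measure R G1 * measure R G2"
    by (intro tendsto_mult weakly_converges_open[OF Rs R conv] assms)
  show "(\<lambda>n. max (measure (Rs n) F1) (measure R F1) * max (measure (Rs n) F2) (measure R F2))
      \<longlonglongrightarrow> measure R F1 * measure R F2"
    by (intro tendsto_mult weakly_converges_closed[OF Rs R conv] assms)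
  show "\<exists>N. \<forall>n\<ge>N. min (measure (Rs n) G1) (measure R G1) * min (measure (Rs n) G2) (measure R G2)
      \<le> max (measure (Rs n) F1) (measure R F1) * max (measure (Rs n) F2) (measure R F2)"
  proof (intro exI allI impI)
    fix n :: nat assume "n \<ge> 1"
    have "min (measure (Rs n) G1) (measure R G1) * min (measure (Rs n) G2) (measure R G2)
        \<le> measure (Rs n) G1 * measure (Rs n) G2"
      by (intro mult_mono) auto
    also have "\<dots> \<le> measure (Rs n) F1 * measure (Rs n) F2" by (rule le) fact
    also have "\<dots> \<le> max (measure (Rs n) F1) (measure R F1) * max (measure (Rs n) F2) (measure R F2)"
      by (intro mult_mono) (auto simp: le_max_iff_disj)
    finally show "min (measure (Rs n) G1) (measure R G1) * min (measure (Rs n) G2) (measure R G2)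
      \<le> max (measure (Rs n) F1) (measure R F1) * max (measure (Rs n) F2) (measure R F2)" .
  qed
qed

section \<open>Closed rectangles as limits of neighbourhoods\<close>

text \<open>A union of balls is empty for empty \<open>S\<close>, whereas \<open>infdist\<close> to
  the empty set is 0 and its sublevel sets would be the whole space. Empty compact sets thus need no
  separate treatment.\<close>

definition nbhd :: "real \<Rightarrow> 'a::metric_space set \<Rightarrow> 'a set" where
  "nbhd e S = (\<Union>x\<in>S. ball x e)"

lemma open_nbhd [simp]: "open (nbhd e S)"
  by (auto simp: nbhd_def)

lemma subset_nbhd: "e > 0 \<Longrightarrow> S \<subseteq> nbhd e S"
  by (auto simp: nbhd_def)

text \<open>One \<open>e\<close> is spent on approximating a point of the closure, the other on
  reaching \<open>S\<close>.\<close>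

lemma closure_nbhd_subset:
  assumes "e > 0"
  shows "closure (nbhd e S) \<subseteq> nbhd (2 * e) S"
proof
  fix x assume "x \<in> closure (nbhd e S)"
  then obtain y where y: "y \<in> nbhd e S" "dist y x < e"
    using assms by (auto simp: closure_approachable)
  then obtain s where "s \<in> S" "dist s y < e" by (auto simp: nbhd_def)
  with y show "x \<in> nbhd (2 * e) S"
    using dist_triangle[of s x y] by (force simp: nbhd_def)
qed

text \<open>A point of all the closures has points of \<open>S\<close> within \<open>2 * e k\<close>
  for every \<open>k\<close>, so it lies in the closure of \<open>S\<close>.\<close>

lemma Inter_closure_nbhd:
  assumes "closed S" and e: "\<And>k. e k > 0" "e \<longlonglongrightarrow> 0"
  shows "(\<Inter>k::nat. closure (nbhd (e k) S)) = S"
proof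
  show "S \<subseteq> (\<Inter>k. closure (nbhd (e k) S))"
    using subset_nbhd[OF e(1)] closure_subset by blast
  show "(\<Inter>k. closure (nbhd (e k) S)) \<subseteq> S"
  proof
    fix x assume "x \<in> (\<Inter>k. closure (nbhd (e k) S))"
    then have x: "x \<in> nbhd (2 * e k) S" for k
      using closure_nbhd_subset[OF e(1)] by blast
    have "x \<in> closure S"
      unfolding closure_approachable
    proof (intro allI impI)
      fix d :: real assume "d > 0"
      then have "eventually (\<lambda>k. e k < d / 2) sequentially"
        by (intro order_tendstoD[OF e(2)]) simp
      then obtain k where "e k < d / 2" by (auto simp: eventually_sequentially)
      with x[of k] show "\<exists>y\<in>S. dist y x < d"
        by (force simp: nbhd_def)
    qed
    then show "x \<in> S" using assms by simp
  qed
qed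

text \<open>Continuity from above of a finite measure: the rectangles decrease to
  \<open>A \<times> B\<close>.\<close>

lemma measure_closure_nbhd_rectangle:
  fixes A B :: "real set"
  assumes R: "plane_distribution R" and "closed A" "closed B"
    and e: "\<And>k::nat. e k > 0" "e \<longlonglongrightarrow> 0" "decseq e"
  shows "(\<lambda>k. measure R (closure (nbhd (e k) A) \<times> closure (nbhd (e k) B)))
    \<longlonglongrightarrow> measure R (A \<times> B)"
proof -
  interpret prob_space R using R by (rule plane_distributionD)
  let ?S = "\<lambda>k. closure (nbhd (e k) A) \<times> closure (nbhd (e k) B)"
  have "nbhd (e l) S \<subseteq> nbhd (e k) S" if "k \<le> l" for k l and S :: "real set"
    using decseqD[OF e(3) that] unfolding nbhd_def by (intro UN_mono subset_ball) auto
  then have "decseq ?S"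
    by (intro decseq_SucI Sigma_mono closure_mono) auto
  moreover have "(\<Inter>k. ?S k) = A \<times> B"
    using Inter_closure_nbhd[OF assms(2) e(1,2)] Inter_closure_nbhd[OF assms(3) e(1,2)] by auto
  moreover have "range ?S \<subseteq> sets R"
    using R by (auto intro!: rectangle_in_sets)
  ultimately show ?thesis
    using finite_Lim_measure_decseq[of ?S] by simp
qed

text \<open>Two limits in succession: first \<open>n\<close> tends to infinity at a fixed radius,
  then the radius tends to 0. The left side is bounded by monotonicity, while on the right the
  closed neighbourhoods shrink back to the closed sets. The bound \<open>d\<close> is there because
  neighbourhoods of ordered sets are ordered only for small radii.\<close>

lemma product_le_limit_rectangles:
  fixes A1 B1 A2 B2 A3 B3 A4 B4 :: "real set"
  assumes Rs: "\<And>n. n \<ge> 1 \<Longrightarrow> plane_distribution (Rs n)" and R: "plane_distribution R"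
    and conv: "weakly_converges Rs R"
    and closed: "closed A3" "closed B3" "closed A4" "closed B4"
    and "d > 0"
    and le: "\<And>e n. 0 < e \<Longrightarrow> e \<le> d \<Longrightarrow> n \<ge> 1 \<Longrightarrow>
      measure (Rs n) (nbhd e A1 \<times> nbhd e B1) * measure (Rs n) (nbhd e A2 \<times> nbhd e B2)
      \<le> measure (Rs n) (nbhd e A3 \<times> nbhd e B3) * measure (Rs n) (nbhd e A4 \<times> nbhd e B4)"
  shows "measure R (A1 \<times> B1) * measure R (A2 \<times> B2) \<le> measure R (A3 \<times> B3) * measure R (A4 \<times> B4)"
proof (rule LIMSEQ_le_const)
  define e where "e k = d / real (Suc k)" for k
  have "(\<lambda>k. d * inverse (real (Suc k))) \<longlonglongrightarrow> d * 0"
    by (intro tendsto_mult tendsto_const LIMSEQ_inverse_real_of_nat)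
  then have "e \<longlonglongrightarrow> 0"
    by (simp add: e_def[abs_def] divide_inverse)
  moreover have "decseq e"
    unfolding decseq_def e_def using \<open>d > 0\<close> by (intro allI impI divide_left_mono) auto
  moreover have "e k > 0" "e k \<le> d" for k
    using \<open>d > 0\<close> by (simp_all add: e_def divide_le_eq)
  ultimately have e: "e k > 0" "e k \<le> d" "e \<longlonglongrightarrow> 0" "decseq e" for k
    by blast+
  let ?C = "\<lambda>k S. closure (nbhd (e k) S)"
  show "(\<lambda>k. measure R (?C k A3 \<times> ?C k B3) * measure R (?C k A4 \<times> ?C k B4))
    \<longlonglongrightarrow> measure R (A3 \<times> B3) * measure R (A4 \<times> B4)"
    by (intro tendsto_mult measure_closure_nbhd_rectangle R closed e)
  have mono: "measure M S \<le> measure M T"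
    if "S \<subseteq> T" "T \<in> sets borel" "plane_distribution M" for M S T
  proof -
    interpret prob_space M using that by (auto dest: plane_distributionD)
    show ?thesis using that by (intro finite_measure_mono) (auto simp: plane_distributionD)
  qed
  have "measure R (A1 \<times> B1) * measure R (A2 \<times> B2)
      \<le> measure R (?C k A3 \<times> ?C k B3) * measure R (?C k A4 \<times> ?C k B4)" for k
  proof -
    have "measure R (A1 \<times> B1) * measure R (A2 \<times> B2)
        \<le> measure R (nbhd (e k) A1 \<times> nbhd (e k) B1) * measure R (nbhd (e k) A2 \<times> nbhd (e k) B2)"
      using R by (intro mult_mono mono Sigma_mono subset_nbhd e) (auto intro!: borel_Times)
    \<comment> \<open>The radius is fixed here: the open neighbourhoods stand on the left, and on
      the right passing to closures only enlarges the product.\<close>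
    also have "\<dots> \<le> measure R (?C k A3 \<times> ?C k B3) * measure R (?C k A4 \<times> ?C k B4)"
    proof (rule product_le_limit_open_closed[OF Rs R conv])
      fix n :: nat assume n: "n \<ge> 1"
      have "measure (Rs n) (nbhd (e k) A1 \<times> nbhd (e k) B1) * measure (Rs n) (nbhd (e k) A2 \<times> nbhd (e k) B2)
          \<le> measure (Rs n) (nbhd (e k) A3 \<times> nbhd (e k) B3) * measure (Rs n) (nbhd (e k) A4 \<times> nbhd (e k) B4)"
        by (rule le) (use e n in auto)
      also have "\<dots> \<le> measure (Rs n) (?C k A3 \<times> ?C k B3) * measure (Rs n) (?C k A4 \<times> ?C k B4)"
        using Rs[OF n]
        by (intro mult_mono mono Sigma_mono closure_subset) (auto intro!: borel_Times)
      finally show "measure (Rs n) (nbhd (e k) A1 \<times> nbhd (e k) B1) * measure (Rs n) (nbhd (e k) A2 \<times> nbhd (e k) B2)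
          \<le> measure (Rs n) (?C k A3 \<times> ?C k B3) * measure (Rs n) (?C k A4 \<times> ?C k B4)" .
    qed (auto intro: open_Times closed_Times)
    finally show ?thesis .
  qed
  then show "\<exists>N. \<forall>k\<ge>N. measure R (A1 \<times> B1) * measure R (A2 \<times> B2)
      \<le> measure R (?C k A3 \<times> ?C k B3) * measure R (?C k A4 \<times> ?C k B4)"
    by blast
qed

text \<open>Disjoint compact sets have a positive distance, and moving points of both by less than
  half of it cannot reverse their order.\<close>

lemma set_less_nbhd:
  assumes "compact K" "compact L" "set_less K L"
  obtains d where "d > 0" "\<And>e. e \<le> d \<Longrightarrow> set_less (nbhd e K) (nbhd e L)"
proof -
  have "K \<inter> L = {}" using assms(3) by (force simp: set_less_def)
  then obtain d where d: "d > 0" "\<forall>x\<in>K. \<forall>y\<in>L. d \<le> dist x y"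
    using separate_compact_closed[of K L] assms compact_imp_closed by auto
  have "set_less (nbhd e K) (nbhd e L)" if "e \<le> d / 2" for e
    unfolding set_less_def
  proof (intro ballI)
    fix a b assume "a \<in> nbhd e K" "b \<in> nbhd e L"
    then obtain x y where "x \<in> K" "y \<in> L" "dist x a < e" "dist y b < e"
      by (auto simp: nbhd_def)
    moreover have "x < y" "d \<le> dist x y"
      using \<open>x \<in> K\<close> \<open>y \<in> L\<close> d assms(3) by (auto simp: set_less_def)
    ultimately show "a < b" using that by (simp add: dist_real_def)
  qed
  with d(1) that[of "d / 2"] show thesis by simp
qed

section \<open>Inner approximation of Borel rectangles\<close>

lemma compact_inner_approx:
  fixes M :: "real measure"
  assumes "finite_measure M" "sets M = sets borel" "A \<in> sets borel" "e > 0"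
  obtains K where "compact K" "K \<subseteq> A" "measure M (A - K) \<le> e"
proof -
  interpret finite_measure M by fact
  show thesis
  proof (cases "measure M A \<le> e")
    \<comment> \<open>Here the empty set is already good enough; in the other case
      \<open>measure M A - e\<close> is positive, so \<open>ennreal\<close> does not truncate
      it.\<close>
    case True
    with that[of "{}"] show thesis by simp
  next
    case False
    have "ennreal (measure M A - e) < emeasure M A"
      using False assms by (simp add: emeasure_eq_measure ennreal_less_iff)
    also have "emeasure M A = (SUP K \<in> {K. K \<subseteq> A \<and> compact K}. emeasure M K)"
      by (rule inner_regular) (use assms in auto)
    finally obtain K where K: "K \<subseteq> A" "compact K" "ennreal (measure M A - e) < emeasure M K"
      by (auto simp: less_SUP_iff)
    then have "measure M A - e < measure M K"
      using False by (simp add: emeasure_eq_measure ennreal_less_iff)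
    moreover have "measure M (A - K) = measure M A - measure M K"
      using K assms by (intro finite_measure_Diff) (auto simp: borel_compact)
    ultimately show thesis using that[of K] K by simp
  qed
qed

text \<open>Inner regularity in the plane would give compact sets that need not be rectangles.
  Applied to the marginal, it approximates one side at a time, with the error measured on a whole
  strip.\<close>

lemma compact_approx_fst:
  assumes R: "plane_distribution R" and A: "A \<in> sets borel" and "e > 0"
  obtains K where "compact K" "K \<subseteq> A" "measure R ((A - K) \<times> UNIV) \<le> e"
proof -
  interpret prob_space R using R by (rule plane_distributionD)
  have "fst \<in> measurable R (borel :: real measure)"
    by (rule fst_measurable[OF R])
  then have "finite_measure (distr R borel fst)" "sets (distr R borel fst) = sets borel"
    by (simp_all add: finite_measure_distr)
  then obtain K where "compact K" "K \<subseteq> A" "measure (first_marginal R) (A - K) \<le> e"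
    using compact_inner_approx[OF _ _ A \<open>e > 0\<close>] unfolding first_marginal_def by blast
  with that[of K] A show thesis
    by (simp add: measure_first_marginal[OF R] borel_compact sets.Diff)
qed

lemma compact_approx_snd:
  assumes R: "plane_distribution R" and B: "B \<in> sets borel" and "e > 0"
  obtains L where "compact L" "L \<subseteq> B" "measure R (UNIV \<times> (B - L)) \<le> e"
proof -
  interpret prob_space R using R by (rule plane_distributionD)
  have snd: "snd \<in> measurable R (borel :: real measure)"
    by (rule snd_measurable[OF R])
  then have "finite_measure (distr R borel snd)" "sets (distr R borel snd) = sets borel"
    by (simp_all add: finite_measure_distr)
  then obtain L where L: "compact L" "L \<subseteq> B" "measure (distr R borel snd) (B - L) \<le> e"
    using compact_inner_approx[OF _ _ B \<open>e > 0\<close>] by blast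
  moreover have "snd -` (B - L) = (UNIV :: real set) \<times> (B - L)" by auto
  ultimately show thesis
    using that[of L] B snd
    by (simp add: measure_distr plane_distributionD[OF R] borel_compact sets.Diff)
qed

text \<open>The part of \<open>A \<times> B\<close> outside \<open>K \<times> L\<close> is covered
  by the two strips, each of mass at most \<open>e\<close>.\<close>

lemma measure_rectangle_approx:
  assumes R: "plane_distribution R"
    and sets: "A \<in> sets borel" "K \<in> sets borel" "B \<in> sets borel" "L \<in> sets borel"
    and sub: "K \<subseteq> A" "L \<subseteq> B"
    and "measure R ((A - K) \<times> UNIV) \<le> e" "measure R (UNIV \<times> (B - L)) \<le> e"
  shows "measure R (K \<times> L) \<le> measure R (A \<times> B)" "measure R (A \<times> B) \<le> measure R (K \<times> L) + 2 * e"
proof -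
  interpret prob_space R using R by (rule plane_distributionD)
  note in_sets = rectangle_in_sets[OF R]
  show "measure R (K \<times> L) \<le> measure R (A \<times> B)"
    using sub sets by (intro finite_measure_mono in_sets) auto
  have "measure R (A \<times> B) \<le> measure R (K \<times> L \<union> ((A - K) \<times> UNIV \<union> UNIV \<times> (B - L)))"
    using sets by (intro finite_measure_mono sets.Un in_sets) auto
  also have "\<dots> \<le> measure R (K \<times> L) + measure R ((A - K) \<times> UNIV \<union> UNIV \<times> (B - L))"
    using sets by (intro measure_Un_le sets.Un in_sets) auto
  also have "measure R ((A - K) \<times> UNIV \<union> UNIV \<times> (B - L))
      \<le> measure R ((A - K) \<times> UNIV) + measure R (UNIV \<times> (B - L))"
    using sets by (intro measure_Un_le in_sets) auto
  finally show "measure R (A \<times> B) \<le> measure R (K \<times> L) + 2 * e" using assms by simp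
qed

text \<open>Approximants with errors \<open>inverse (real (Suc k))\<close> converge to
  \<open>p\<close> and \<open>q\<close>, so the bound passes to the product of the limits.\<close>

lemma mult_le_of_approx:
  fixes p q c :: real
  assumes "\<And>e. e > 0 \<Longrightarrow> \<exists>p' q'. p' \<le> p \<and> p \<le> p' + e \<and> q' \<le> q \<and> q \<le> q' + e \<and> p' * q' \<le> c"
  shows "p * q \<le> c"
proof -
  have "\<forall>k. \<exists>p' q'. p' \<le> p \<and> p \<le> p' + inverse (real (Suc k)) \<and>
      q' \<le> q \<and> q \<le> q' + inverse (real (Suc k)) \<and> p' * q' \<le> c"
    using assms by simp
  then obtain f g where fg: "\<And>k. f k \<le> p" "\<And>k. p \<le> f k + inverse (real (Suc k))"
      "\<And>k. g k \<le> q" "\<And>k. q \<le> g k + inverse (real (Suc k))" "\<And>k. f k * g k \<le> c"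
    by metis
  have lim: "h \<longlonglongrightarrow> r" if "\<And>k. h k \<le> r" "\<And>k. r \<le> h k + inverse (real (Suc k))" for h r
  proof (rule tendsto_sandwich[of "\<lambda>k. r - inverse (real (Suc k))" _ _ "\<lambda>_. r"])
    have "(\<lambda>k. r - inverse (real (Suc k))) \<longlonglongrightarrow> r - 0"
      by (intro tendsto_diff tendsto_const LIMSEQ_inverse_real_of_nat)
    then show "(\<lambda>k. r - inverse (real (Suc k))) \<longlonglongrightarrow> r" by simp
  qed (use that in \<open>auto intro!: always_eventually simp: algebra_simps\<close>)
  have "(\<lambda>k. f k * g k) \<longlonglongrightarrow> p * q"
    by (intro tendsto_mult lim fg)
  then show ?thesis
    by (rule LIMSEQ_le_const2) (use fg(5) in blast)
qed

section \<open>Passage to the limit\<close>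

lemma TP2_limit:
  assumes Rs: "\<And>n. n \<ge> 1 \<Longrightarrow> plane_distribution (Rs n)" and R: "plane_distribution R"
    and conv: "weakly_converges Rs R" and TP2: "\<And>n. n \<ge> 1 \<Longrightarrow> TP2 (Rs n)"
  shows "TP2 R"
  unfolding TP2_def
proof (intro ballI impI)
  interpret prob_space R using R by (rule plane_distributionD)
  fix A1 A2 B1 B2 :: "real set"
  assume sets: "A1 \<in> sets borel" "A2 \<in> sets borel" "B1 \<in> sets borel" "B2 \<in> sets borel"
    and less: "set_less A1 A2" "set_less B1 B2"
  show "measure R (A1 \<times> B2) * measure R (A2 \<times> B1) \<le> measure R (A1 \<times> B1) * measure R (A2 \<times> B2)"
  proof (rule mult_le_of_approx)
    fix e :: real assume "e > 0"
    \<comment> \<open>Each rectangle loses mass in two strips, hence half of \<open>e\<close> for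
      each.\<close>
    then have "e / 2 > 0" by simp
    note fst = compact_approx_fst[OF R _ this] and snd = compact_approx_snd[OF R _ this]
    obtain K1 where K1: "compact K1" "K1 \<subseteq> A1" "measure R ((A1 - K1) \<times> UNIV) \<le> e / 2"
      using fst[OF sets(1)] .
    obtain K2 where K2: "compact K2" "K2 \<subseteq> A2" "measure R ((A2 - K2) \<times> UNIV) \<le> e / 2"
      using fst[OF sets(2)] .
    obtain L1 where L1: "compact L1" "L1 \<subseteq> B1" "measure R (UNIV \<times> (B1 - L1)) \<le> e / 2"
      using snd[OF sets(3)] .
    obtain L2 where L2: "compact L2" "L2 \<subseteq> B2" "measure R (UNIV \<times> (B2 - L2)) \<le> e / 2"
      using snd[OF sets(4)] .
    have "set_less K1 K2" "set_less L1 L2"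
      using less K1 K2 L1 L2 unfolding set_less_def by blast+
    then obtain d d' where d: "d > 0" "\<And>e. e \<le> d \<Longrightarrow> set_less (nbhd e K1) (nbhd e K2)"
      and d': "d' > 0" "\<And>e. e \<le> d' \<Longrightarrow> set_less (nbhd e L1) (nbhd e L2)"
      using set_less_nbhd[OF K1(1) K2(1)] set_less_nbhd[OF L1(1) L2(1)] by metis
    have "measure R (K1 \<times> L2) * measure R (K2 \<times> L1) \<le> measure R (K1 \<times> L1) * measure R (K2 \<times> L2)"
    proof (rule product_le_limit_rectangles[OF Rs R conv])
      \<comment> \<open>At radii up to this minimum the neighbourhoods are ordered in both
        coordinates at once, so \<open>TP2\<close> of \<open>Rs n\<close> applies to them.\<close>
      show "min d d' > 0" using d d' by simp
      show "measure (Rs n) (nbhd e K1 \<times> nbhd e L2) * measure (Rs n) (nbhd e K2 \<times> nbhd e L1)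
          \<le> measure (Rs n) (nbhd e K1 \<times> nbhd e L1) * measure (Rs n) (nbhd e K2 \<times> nbhd e L2)"
        if "e \<le> min d d'" "n \<ge> 1" for e n
        using TP2[OF that(2)] d(2) d'(2) that(1) unfolding TP2_def by simp
    qed (use K1 K2 L1 L2 compact_imp_closed in auto)
    \<comment> \<open>Only the left side needs approximation; the right side grows when the compact
      sides are replaced by the Borel sets containing them.\<close>
    also have "\<dots> \<le> measure R (A1 \<times> B1) * measure R (A2 \<times> B2)"
      using K1 K2 L1 L2 sets by (intro mult_mono finite_measure_mono rectangle_in_sets[OF R]) auto
    finally show "\<exists>p' q'. p' \<le> measure R (A1 \<times> B2) \<and> measure R (A1 \<times> B2) \<le> p' + e \<and>
        q' \<le> measure R (A2 \<times> B1) \<and> measure R (A2 \<times> B1) \<le> q' + e \<and>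
        p' * q' \<le> measure R (A1 \<times> B1) * measure R (A2 \<times> B2)"
      using measure_rectangle_approx[OF R sets(1) _ sets(4) _ K1(2) L2(2) K1(3) L2(3)]
        measure_rectangle_approx[OF R sets(2) _ sets(3) _ K2(2) L1(2) K2(3) L1(3)]
        K1(1) K2(1) L1(1) L2(1)
      by (intro exI[of _ "measure R (K1 \<times> L2)"] exI[of _ "measure R (K2 \<times> L1)"])
         (simp add: borel_compact)
  qed
qed

section \<open>Half-lines and the stochastic order\<close>

lemma nbhd_UNIV: "e > 0 \<Longrightarrow> nbhd e UNIV = UNIV"
  using subset_nbhd[of e UNIV] by auto

text \<open>Neighbourhoods of a closed half-line are open half-lines, the very sets that occur in
  \<open>stochastically_ordered\<close>.\<close>

lemma nbhd_atLeast:
  fixes z :: real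
  assumes "e > 0"
  shows "nbhd e {z..} = {z - e<..}"
proof (intro set_eqI iffI)
  fix x assume "x \<in> {z - e<..}"
  \<comment> \<open>The witness is the point of \<open>{z..}\<close> nearest to
    \<open>x\<close>.\<close>
  then have "max z x \<in> {z..}" "x \<in> ball (max z x) e"
    using assms by (simp_all add: dist_real_def max_def)
  then show "x \<in> nbhd e {z..}" unfolding nbhd_def by (rule UN_I)
qed (auto simp: nbhd_def dist_real_def)

text \<open>The first sides are approximated by compact sets as for \<open>TP2\<close>. The second
  sides must remain half-lines or \<open>UNIV\<close> for the order of \<open>Rs n\<close> to apply;
  they are closed, which is what the limit of rectangles asks for.\<close>

lemma stochastically_ordered_limit:
  assumes Rs: "\<And>n. n \<ge> 1 \<Longrightarrow> plane_distribution (Rs n)" and R: "plane_distribution R"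
    and conv: "weakly_converges Rs R" and ord: "\<And>n. n \<ge> 1 \<Longrightarrow> stochastically_ordered (Rs n)"
  shows "stochastically_ordered R"
  unfolding stochastically_ordered_def
proof (intro ballI allI impI)
  interpret prob_space R using R by (rule plane_distributionD)
  fix A1 A2 :: "real set" and y :: real
  assume sets: "A1 \<in> sets borel" "A2 \<in> sets borel" and less: "set_less A1 A2"
  have "measure R (A1 \<times> {y<..}) * measure R (A2 \<times> UNIV)
      \<le> measure R (A1 \<times> UNIV) * measure R (A2 \<times> {y<..})"
  proof (rule mult_le_of_approx)
    fix e :: real assume "e > 0"
    then have "e / 2 > 0" by simp
    note fst = compact_approx_fst[OF R _ this] and snd = compact_approx_snd[OF R _ this]
    obtain K1 where K1: "compact K1" "K1 \<subseteq> A1" "measure R ((A1 - K1) \<times> UNIV) \<le> e / 2"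
      using fst[OF sets(1)] .
    obtain K2 where K2: "compact K2" "K2 \<subseteq> A2" "measure R ((A2 - K2) \<times> UNIV) \<le> e / 2"
      using fst[OF sets(2)] .
    obtain L where L: "compact L" "L \<subseteq> {y<..}" "measure R (UNIV \<times> ({y<..} - L)) \<le> e / 2"
      using snd[of "{y<..}"] by auto
    \<comment> \<open>The compact set \<open>L\<close> is enlarged to a closed half-line still
      inside \<open>{y<..}\<close>, starting at the minimum of \<open>L\<close>; this can only
      reduce the lost mass. For empty \<open>L\<close> any \<open>z\<close> above \<open>y\<close>
      will do.\<close>
    obtain z where z: "z > y" "L \<subseteq> {z..}"
    proof (cases "L = {}")
      case True
      with that[of "y + 1"] show thesis by simp
    next
      case False
      then obtain z where "z \<in> L" "\<forall>x\<in>L. z \<le> x" using compact_attains_inf[OF L(1)] by blast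
      with that[of z] L(2) show thesis by auto
    qed
    have "measure R (UNIV \<times> ({y<..} - {z..})) \<le> measure R (UNIV \<times> ({y<..} - L))"
      using z L(1) by (intro finite_measure_mono rectangle_in_sets[OF R]) (auto simp: borel_compact)
    then have Z: "measure R (UNIV \<times> ({y<..} - {z..})) \<le> e / 2" using L(3) by simp
    have sub: "{z..} \<subseteq> {y<..}" using z by auto
    have "set_less K1 K2" using less K1 K2 unfolding set_less_def by blast
    then obtain d where d: "d > 0" "\<And>e. e \<le> d \<Longrightarrow> set_less (nbhd e K1) (nbhd e K2)"
      using set_less_nbhd[OF K1(1) K2(1)] by metis
    have "measure R (K1 \<times> {z..}) * measure R (K2 \<times> UNIV)
        \<le> measure R (K1 \<times> UNIV) * measure R (K2 \<times> {z..})"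
    proof (rule product_le_limit_rectangles[OF Rs R conv _ _ _ _ d(1)])
      \<comment> \<open>This is the order of \<open>Rs n\<close> at the threshold
        \<open>z - e\<close> in place of \<open>y\<close>.\<close>
      show "measure (Rs n) (nbhd e K1 \<times> nbhd e {z..}) * measure (Rs n) (nbhd e K2 \<times> nbhd e UNIV)
          \<le> measure (Rs n) (nbhd e K1 \<times> nbhd e UNIV) * measure (Rs n) (nbhd e K2 \<times> nbhd e {z..})"
        if "0 < e" "e \<le> d" "n \<ge> 1" for e n
        using ord[OF that(3)] d(2)[OF that(2)] that(1) unfolding stochastically_ordered_def
        by (simp add: nbhd_atLeast nbhd_UNIV measure_first_marginal[OF Rs[OF that(3)]])
    qed (use K1 K2 compact_imp_closed in auto)
    also have "\<dots> \<le> measure R (A1 \<times> UNIV) * measure R (A2 \<times> {y<..})"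
      using K1 K2 sub sets by (intro mult_mono finite_measure_mono rectangle_in_sets[OF R]) auto
    finally show "\<exists>p' q'. p' \<le> measure R (A1 \<times> {y<..}) \<and> measure R (A1 \<times> {y<..}) \<le> p' + e \<and>
        q' \<le> measure R (A2 \<times> UNIV) \<and> measure R (A2 \<times> UNIV) \<le> q' + e \<and>
        p' * q' \<le> measure R (A1 \<times> UNIV) * measure R (A2 \<times> {y<..})"
      \<comment> \<open>In the second instance both second sides are \<open>UNIV\<close>, so the
        strip in that coordinate is empty and its bound follows from \<open>e > 0\<close>.\<close>
      using measure_rectangle_approx[OF R sets(1) _ _ _ K1(2) sub K1(3) Z]
        measure_rectangle_approx[OF R sets(2) _ _ _ K2(2) subset_refl[of UNIV] K2(3)]
        K1(1) K2(1) \<open>e > 0\<close>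
      by (intro exI[of _ "measure R (K1 \<times> {z..})"] exI[of _ "measure R (K2 \<times> UNIV)"])
         (simp add: borel_compact)
  qed
  then show "measure R (A1 \<times> {y<..}) * measure (first_marginal R) A2
      \<le> measure (first_marginal R) A1 * measure R (A2 \<times> {y<..})"
    using sets by (simp add: measure_first_marginal[OF R])
qed

theorem lemma19:
  fixes Rs :: "nat \<Rightarrow> (real \<times> real) measure" and R :: "(real \<times> real) measure"
  assumes "\<And>n. n \<ge> 1 \<Longrightarrow> plane_distribution (Rs n)"
    and "plane_distribution R"
    and "weakly_converges Rs R"
  shows "((\<forall>n\<ge>1. stochastically_ordered (Rs n)) \<longrightarrow> stochastically_ordered R) \<and>
         ((\<forall>n\<ge>1. TP2 (Rs n)) \<longrightarrow> TP2 R)"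
  using stochastically_ordered_limit[OF assms] TP2_limit[OF assms] by blast

end
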